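(* There exists a unicyclic graph $G$ such that $\mu(L(G))\neq\mu(G)$.
   Context: All graphs are finite, simple, undirected and connected. A unicyclic graph is a connected graph containing exactly one cycle. For a graph $G$ and $X\subseteq V(G)$, two vertices $u,v$ are $X$-visible if there is a shortest $(u,v)$-path in $G$ all of whose internal vertices lie outside $X$. A set $X\subseteq V(G)$ is a mutual-visibility set of $G$ if every pair of vertices of $X$ is $X$-visible. The mutual-visibility number $\mu(G)$ is the maximum cardinality of a mutual-visibility set of $G$. The line graph $L(G)$ has vertex set $E(G)$, two vertices being adjacent if and only if the corresponding (distinct) edges of $G$ share an endpoint. *)

theory Defs
  imports "Graph_Theory.Graph_Theory"
begin

text \<open>
  A finite simple undirected graph is a \<^locale>\<open>pair_graph\<close>: an undirected edge between \<open>u\<close> and \<open>v\<close>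
  is represented by the two arcs \<open>(u, v)\<close> and \<open>(v, u)\<close>. The following function forgets the
  orientation of an arc.
\<close>

definition uedge :: "'a \<times> 'a \<Rightarrow> 'a set" where
  "uedge a = {fst a, snd a}"

definition uedges :: "'a pair_pre_digraph \<Rightarrow> 'a set set" where
  "uedges G = uedge ` parcs G"

text \<open>
  In a symmetric digraph, \<^const>\<open>pre_digraph.cycle\<close> also accepts the closed walk along \<open>(u, v)\<close>
  and \<open>(v, u)\<close>, which is no cycle of the undirected graph; hence the length bound.
  One undirected cycle is traversed by many arc lists (choice of starting point and direction),
  and as a subgraph it is determined by its set of undirected edges, so cycles are counted as
  edge sets.
\<close>

definition ucycles :: "'a pair_pre_digraph \<Rightarrow> 'a set set set" where
  "ucycles G = {uedge ` set p | p. pre_digraph.cycle (with_proj G) p \<and> length p \<ge> 3}"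

definition unicyclic :: "'a pair_pre_digraph \<Rightarrow> bool" where
  "unicyclic G \<longleftrightarrow> Digraph_Component.connected (with_proj G) \<and> (\<exists>!C. C \<in> ucycles G)"

definition shortest_path ::
    "'a pair_pre_digraph \<Rightarrow> 'a \<Rightarrow> ('a \<times> 'a) awalk \<Rightarrow> 'a \<Rightarrow> bool" where
  "shortest_path G u p v \<longleftrightarrow>
     pre_digraph.apath (with_proj G) u p v \<and>
     (\<forall>q. pre_digraph.apath (with_proj G) u q v \<longrightarrow> length p \<le> length q)"

definition visible :: "'a pair_pre_digraph \<Rightarrow> 'a set \<Rightarrow> 'a \<Rightarrow> 'a \<Rightarrow> bool" where
  "visible G X u v \<longleftrightarrow>
     (\<exists>p. shortest_path G u p v \<and> set (pre_digraph.inner_verts (with_proj G) p) \<inter> X = {})"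

definition mutual_visibility_set :: "'a pair_pre_digraph \<Rightarrow> 'a set \<Rightarrow> bool" where
  "mutual_visibility_set G X \<longleftrightarrow>
     X \<subseteq> pverts G \<and> (\<forall>u\<in>X. \<forall>v\<in>X. u \<noteq> v \<longrightarrow> visible G X u v)"

definition mutual_visibility_number :: "'a pair_pre_digraph \<Rightarrow> nat" where
  "mutual_visibility_number G = Max {card X | X. mutual_visibility_set G X}"

definition line_graph :: "'a pair_pre_digraph \<Rightarrow> 'a set pair_pre_digraph" where
  "line_graph G =
     \<lparr> pverts = uedges G,
       parcs = {(e, f). e \<in> uedges G \<and> f \<in> uedges G \<and> e \<noteq> f \<and> e \<inter> f \<noteq> {}} \<rparr>"

lemma pair_graph_line_graph:
  assumes "pair_graph G"
  shows "pair_graph (line_graph G)"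
proof -
  interpret pair_graph G by fact
  have fin: "finite (uedges G)"
    by (simp add: uedges_def pair_finite_arcs)
  have "parcs (line_graph G) \<subseteq> uedges G \<times> uedges G"
    by (auto simp: line_graph_def)
  then have fin_arcs: "finite (parcs (line_graph G))"
    using fin by (meson finite_SigmaI finite_subset)
  show ?thesis
    by unfold_locales
      (use fin fin_arcs in \<open>auto simp: line_graph_def symmetric_def intro!: symI\<close>)
qed

text \<open>The maximum defining the mutual-visibility number is taken over a finite nonempty set.\<close>

lemma mutual_visibility_number_wf:
  assumes "pair_graph G"
  shows "finite {card X | X. mutual_visibility_set G X}"
    and "{card X | X. mutual_visibility_set G X} \<noteq> {}"
proof -
  interpret pair_graph G by fact
  have "{card X | X. mutual_visibility_set G X} \<subseteq> card ` Pow (pverts G)"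
    by (auto simp: mutual_visibility_set_def)
  then show "finite {card X | X. mutual_visibility_set G X}"
    using pair_finite_verts by (meson finite_Pow_iff finite_imageI finite_subset)
  have "mutual_visibility_set G {}"
    by (simp add: mutual_visibility_set_def)
  then show "{card X | X. mutual_visibility_set G X} \<noteq> {}"
    by blast
qed

end

theory Submission
  imports Defs
begin

text \<open>
  The witness is the bull: a triangle \<open>0, 1, 2\<close> with pendant vertices \<open>3\<close> at \<open>0\<close> and \<open>4\<close> at \<open>1\<close>.
  A pendant vertex sees other vertices only through its neighbour, so a mutual-visibility set with
  more than two elements contains at most one of \<open>0, 3\<close> and at most one of \<open>1, 4\<close>; hence it has at
  most three elements. In the line graph the edge \<open>{0, 1}\<close> is adjacent to all others, so the other
  four edges form a mutual-visibility set.
\<close>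

section \<open>Criteria for visibility, and a bound on the length of cycles\<close>

context pair_wf_digraph
begin

lemma visible_of_arc:
  assumes "(u, v) \<in> parcs G" "u \<noteq> v"
  shows "visible G X u v"
proof -
  have "apath u [(u, v)] v"
    using assms by (simp add: apath_simps in_arcsD2)
  moreover have "length [(u, v)] \<le> length q" if "apath u q v" for q
    using that assms(2) by (cases q) (auto simp: apath_simps)
  ultimately have "shortest_path G u [(u, v)] v"
    by (simp add: shortest_path_def)
  then show ?thesis
    by (force simp: visible_def inner_verts_def)
qed

text \<open>Non-adjacency and \<open>u \<noteq> v\<close> exclude paths with fewer than two arcs, so
  the path through \<open>w\<close> is shortest, and \<open>w\<close> is its only inner
  vertex.\<close>

lemma visible_of_common_neighbour:
  assumes "(u, w) \<in> parcs G" "(w, v) \<in> parcs G" "(u, v) \<notin> parcs G"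
    and "u \<noteq> w" "w \<noteq> v" "u \<noteq> v" "w \<notin> X"
  shows "visible G X u v"
proof -
  have "apath u [(u, w), (w, v)] v"
    using assms by (simp add: apath_simps in_arcsD2)
  moreover have "length [(u, w), (w, v)] \<le> length q" if "apath u q v" for q
  proof (cases q)
    case Nil
    then show ?thesis
      using that assms(6) by (simp add: apath_simps)
  next
    case (Cons a r)
    then show ?thesis
      using that assms(3) by (cases a; cases r) (auto simp: apath_simps)
  qed
  ultimately have "shortest_path G u [(u, w), (w, v)] v"
    by (simp add: shortest_path_def)
  then show ?thesis
    using assms(7) by (force simp: visible_def inner_verts_def)
qed

text \<open>Any path from \<open>u\<close> to \<open>v\<close> must begin with the arc
  \<open>(u, w)\<close> and, as \<open>w \<noteq> v\<close>, continue beyond it. So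
  \<open>w\<close>, an element of \<open>X\<close>, is an inner vertex.\<close>

lemma not_visible_past_unique_neighbour:
  assumes unique: "\<And>y. (u, y) \<in> parcs G \<Longrightarrow> y = w"
    and "w \<in> X" "u \<noteq> v" "w \<noteq> v"
  shows "\<not> visible G X u v"
proof
  assume "visible G X u v"
  then obtain p where p: "apath u p v" "set (inner_verts p) \<inter> X = {}"
    by (auto simp: visible_def shortest_path_def)
  then obtain r where r: "p = (u, w) # r"
    using assms(3) unique by (cases p) (auto simp: apath_simps)
  then obtain y s where "r = (w, y) # s"
    using p(1) assms(4) by (cases r) (auto simp: apath_simps)
  with p(2) r assms(2) show False
    by (simp add: inner_verts_def)
qed

text \<open>A third element of \<open>X\<close> would be hidden from \<open>u\<close> behind
  \<open>w\<close>. This yields the upper bound for graphs with pendant vertices.\<close>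

lemma mutual_visibility_set_pendant:
  assumes "mutual_visibility_set G X" "u \<in> X" "w \<in> X"
    and "\<And>y. (u, y) \<in> parcs G \<Longrightarrow> y = w"
  shows "X \<subseteq> {u, w}"
proof
  fix v assume "v \<in> X"
  show "v \<in> {u, w}"
  proof (rule ccontr)
    assume "v \<notin> {u, w}"
    then have "u \<noteq> v" "w \<noteq> v"
      by auto
    then have "\<not> visible G X u v"
      using not_visible_past_unique_neighbour assms(3,4) by blast
    with assms(1,2) \<open>v \<in> X\<close> \<open>u \<noteq> v\<close> show False
      by (auto simp: mutual_visibility_set_def)
  qed
qed

text \<open>The vertices visited after the start are pairwise distinct, and there are
  \<open>length p\<close> of them; \<open>tl\<close> drops the starting vertex, which recurs at the
  end.\<close>

lemma length_cycle_le:
  assumes "cycle p" "finite (pverts G)"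
  shows "length p \<le> card (pverts G)"
proof -
  obtain u where u: "awalk u p u" "distinct (tl (pawalk_verts u p))"
    using assms(1) unfolding cycle_def by blast
  have len: "length (pawalk_verts x p) = Suc (length p)" for x
    by (induction p arbitrary: x) auto
  have "set (pawalk_verts u p) \<subseteq> pverts G"
    using u(1) awalk_verts_in_verts unfolding awalk_def by blast
  then have "set (tl (pawalk_verts u p)) \<subseteq> pverts G"
    by (cases "pawalk_verts u p") simp_all
  then have "card (set (tl (pawalk_verts u p))) \<le> card (pverts G)"
    using assms(2) by (rule card_mono[rotated])
  with u(2) len show ?thesis
    by (simp add: distinct_card)
qed

end

lemma (in pair_graph) card_le_mutual_visibility_number:
  assumes "mutual_visibility_set G X"
  shows "card X \<le> mutual_visibility_number G"
  unfolding mutual_visibility_number_def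
  using mutual_visibility_number_wf(1)[OF pair_graph_axioms] assms by (auto intro: Max_ge)

lemma (in pair_graph) mutual_visibility_number_le:
  assumes "\<And>X. mutual_visibility_set G X \<Longrightarrow> card X \<le> n"
  shows "mutual_visibility_number G \<le> n"
  unfolding mutual_visibility_number_def
  using mutual_visibility_number_wf[OF pair_graph_axioms] assms by (subst Max_le_iff) auto

text \<open>By symmetry of the arcs, every vertex also reaches \<open>r\<close>, so any two vertices
  are joined through \<open>r\<close>.\<close>

lemma (in pair_sym_digraph) connected_if_reachable_from:
  assumes "r \<in> pverts G" "\<And>v. v \<in> pverts G \<Longrightarrow> r \<rightarrow>\<^sup>*\<^bsub>with_proj G\<^esub> v"
  shows "connected G"
proof -
  have "u \<rightarrow>\<^sup>*\<^bsub>with_proj G\<^esub> v" if "u \<in> pverts G" "v \<in> pverts G" for u v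
    using that assms(2) symmetric_reachable' reachable_trans by blast
  then show ?thesis
    using assms(1) by (intro connectedI) (auto intro: reachable_mk_symmetricI)
qed

section \<open>The bull: connectedness and its only cycle\<close>

definition bull :: "nat pair_pre_digraph" where
  "bull = \<lparr> pverts = {0, 1, 2, 3, 4},
     parcs = {(0, 1), (1, 0), (0, 2), (2, 0), (1, 2), (2, 1), (0, 3), (3, 0), (1, 4), (4, 1)} \<rparr>"

lemma bull_simps:
  "pverts bull = {0, 1, 2, 3, 4}"
  "parcs bull = {(0, 1), (1, 0), (0, 2), (2, 0), (1, 2), (2, 1), (0, 3), (3, 0), (1, 4), (4, 1)}"
  by (simp_all add: bull_def)

lemma pair_graph_bull: "pair_graph bull"
  by unfold_locales (auto simp: bull_simps symmetric_def intro!: symI)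

interpretation bull: pair_graph bull
  by (rule pair_graph_bull)

lemma uedges_bull: "uedges bull = {{0, 1}, {0, 2}, {1, 2}, {0, 3}, {1, 4}}"
  by (auto simp: uedges_def uedge_def bull_simps)

interpretation line_bull: pair_graph "line_graph bull"
  by (rule pair_graph_line_graph[OF pair_graph_bull])

lemma connected_bull: "Digraph_Component.connected (with_proj bull)"
proof (rule bull.connected_if_reachable_from[of 0])
  fix v assume "v \<in> pverts bull"
  moreover have "0 \<rightarrow>\<^sup>*\<^bsub>with_proj bull\<^esub> 1" "1 \<rightarrow>\<^sup>*\<^bsub>with_proj bull\<^esub> 4" "0 \<rightarrow>\<^sup>*\<^bsub>with_proj bull\<^esub> 2"
    "0 \<rightarrow>\<^sup>*\<^bsub>with_proj bull\<^esub> 3"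
    by (rule bull.reachable_adjI; simp add: bull_simps)+
  moreover from this(1,2) have "0 \<rightarrow>\<^sup>*\<^bsub>with_proj bull\<^esub> 4"
    by (rule bull.reachable_trans)
  ultimately show "0 \<rightarrow>\<^sup>*\<^bsub>with_proj bull\<^esub> v"
    by (auto simp: bull_simps intro: bull.reachable_refl)
qed (simp add: bull_simps)

text \<open>The vertices \<open>3\<close> and \<open>4\<close> have a single neighbour each, so
  neither lies between two different vertices. This confines every cycle to the triangle.\<close>

lemma bull_two_neighbours:
  assumes "(x, y) \<in> parcs bull" "(y, z) \<in> parcs bull" "x \<noteq> z"
  shows "y \<in> {0, 1, 2}"
  using assms unfolding bull_simps by (elim insertE emptyE) simp_all

lemma uedges_cycle_bull:
  assumes "bull.cycle p" "length p \<ge> 3"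
  shows "uedge ` set p = {{0, 1}, {0, 2}, {1, 2}}"
proof -
  obtain u where u: "bull.awalk u p u" "distinct (tl (pawalk_verts u p))"
    using assms(1) unfolding bull.cycle_def by blast
  have "length p \<le> 5"
    using bull.length_cycle_le[OF assms(1)] by (simp add: bull_simps)
  with assms(2) consider "length p = 3" | "length p = 4" | "length p = 5"
    by linarith
  then show ?thesis
  proof cases
    case 1
    then obtain a b where "p = [(u, a), (a, b), (b, u)]"
      using u(1) by (auto simp: numeral_eq_Suc length_Suc_conv bull.awalk_simps)
    moreover from this u have "(u, a) \<in> parcs bull" "(a, b) \<in> parcs bull" "(b, u) \<in> parcs bull"
      and "distinct [a, b, u]"
      by (auto simp: bull.awalk_simps)
    then have "{a, b, u} \<subseteq> {0, 1, 2}" and "distinct [a, b, u]"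
      using bull_two_neighbours[of u a b] bull_two_neighbours[of a b u]
        bull_two_neighbours[of b u a] by auto
    \<comment> \<open>Being distinct, \<open>a\<close>, \<open>b\<close>, \<open>u\<close> exhaust
      the triangle; each of the orderings gives the same edge set.\<close>
    then have "{{u, a}, {a, b}, {b, u}} = {{0, 1}, {0, 2}, {1, 2}}"
      by (elim insertE emptyE insert_subset[THEN iffD1, THEN conjE]) (simp_all add: insert_commute)
    ultimately show ?thesis
      by (simp add: uedge_def)
  next
    case 2
    then obtain a b c where "p = [(u, a), (a, b), (b, c), (c, u)]"
      using u(1) by (auto simp: numeral_eq_Suc length_Suc_conv bull.awalk_simps)
    with u have "(u, a) \<in> parcs bull" "(a, b) \<in> parcs bull" "(b, c) \<in> parcs bull"
      "(c, u) \<in> parcs bull" and dist: "distinct [a, b, c, u]"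
      by (auto simp: bull.awalk_simps)
    then have "set [a, b, c, u] \<subseteq> {0, 1, 2}"
      using bull_two_neighbours[of u a b] bull_two_neighbours[of a b c]
        bull_two_neighbours[of b c u] bull_two_neighbours[of c u a] by auto
    \<comment> \<open>Four distinct vertices do not fit into the triangle, so this case is
      contradictory; length five fails likewise.\<close>
    then have "card (set [a, b, c, u]) \<le> card {0, 1, 2 :: nat}"
      by (rule card_mono[rotated]) simp
    then show ?thesis
      unfolding distinct_card[OF dist] by simp
  next
    case 3
    then obtain a b c d where "p = [(u, a), (a, b), (b, c), (c, d), (d, u)]"
      using u(1) by (auto simp: numeral_eq_Suc length_Suc_conv bull.awalk_simps)
    with u have "(u, a) \<in> parcs bull" "(a, b) \<in> parcs bull" "(b, c) \<in> parcs bull"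
      "(c, d) \<in> parcs bull" "(d, u) \<in> parcs bull" and dist: "distinct [a, b, c, d, u]"
      by (auto simp: bull.awalk_simps)
    then have "set [a, b, c, d, u] \<subseteq> {0, 1, 2}"
      using bull_two_neighbours[of u a b] bull_two_neighbours[of a b c]
        bull_two_neighbours[of b c d] bull_two_neighbours[of c d u]
        bull_two_neighbours[of d u a] by auto
    then have "card (set [a, b, c, d, u]) \<le> card {0, 1, 2 :: nat}"
      by (rule card_mono[rotated]) simp
    then show ?thesis
      unfolding distinct_card[OF dist] by simp
  qed
qed

lemma unicyclic_bull: "unicyclic bull"
proof -
  have ucyclesI: "uedge ` set p \<in> ucycles bull" if "bull.cycle p" "3 \<le> length p" for p
    using that unfolding ucycles_def by blast
  have "bull.awalk 0 [(0, 1), (1, 2), (2, 0)] 0"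
    by (simp add: bull.awalk_def bull_simps)
  then have "bull.cycle [(0, 1), (1, 2), (2, 0)]"
    unfolding bull.cycle_def by (intro exI[of _ 0] conjI) simp_all
  then have "uedge ` set [(0, 1), (1, 2), (2, 0)] \<in> ucycles bull"
    by (rule ucyclesI) simp
  moreover have "C = {{0, 1}, {0, 2}, {1, 2}}" if "C \<in> ucycles bull" for C
    using that uedges_cycle_bull unfolding ucycles_def by blast
  ultimately show ?thesis
    unfolding unicyclic_def using connected_bull by metis
qed

section \<open>Bounds on the two mutual-visibility numbers\<close>

lemma mutual_visibility_number_bull: "mutual_visibility_number bull \<le> 3"
proof (rule bull.mutual_visibility_number_le)
  fix X assume X: "mutual_visibility_set bull X"
  then have sub: "X \<subseteq> {0, 1, 2, 3, 4}"
    by (simp add: mutual_visibility_set_def bull_simps)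
  show "card X \<le> 3"
  \<comment> \<open>If \<open>X\<close> contains a pendant vertex together with its neighbour, it is
    that pair.\<close>
  proof (cases "{0, 3} \<subseteq> X \<or> {1, 4} \<subseteq> X")
    case True
    then have "X \<subseteq> {3, 0} \<or> X \<subseteq> {4, 1}"
      using bull.mutual_visibility_set_pendant[OF X, of 3 0]
        bull.mutual_visibility_set_pendant[OF X, of 4 1] by (auto simp: bull_simps)
    then have "card X \<le> card {3, 0 :: nat} \<or> card X \<le> card {4, 1 :: nat}"
      by (meson card_mono finite.emptyI finite.insertI)
    then show ?thesis
      by simp
  next
    case False
    \<comment> \<open>Here \<open>a\<close> stands for the one element of \<open>{0, 3}\<close> that
      \<open>X\<close> may contain, and \<open>b\<close> for that of \<open>{1, 4}\<close>.\<close>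
    with sub obtain a b where "X \<subseteq> {a, b, 2}"
      by (cases "0 \<in> X"; cases "1 \<in> X") blast+
    then have "card X \<le> card {a, b, 2}"
      by (simp add: card_mono)
    also have "\<dots> \<le> 3"
      by (simp add: card_insert_if)
    finally show ?thesis .
  qed
qed

lemma mutual_visibility_number_line_graph_bull:
  "4 \<le> mutual_visibility_number (line_graph bull)"
proof -
  let ?X = "{{0, 2}, {1, 2}, {0, 3}, {1, 4}} :: nat set set"
  have X: "e \<in> uedges bull \<and> e \<noteq> {0, 1} \<and> e \<inter> {0, 1} \<noteq> {}" if "e \<in> ?X" for e
    using that unfolding uedges_bull by (elim insertE emptyE) (simp_all add: doubleton_eq_iff)
  have centre: "{0, 1} \<in> uedges bull" "{0, 1} \<notin> ?X"
    by (simp_all add: uedges_bull doubleton_eq_iff)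
  have vis: "visible (line_graph bull) ?X e f" if "e \<in> ?X" "f \<in> ?X" "e \<noteq> f" for e f
  \<comment> \<open>Edges of \<open>?X\<close> that share an endpoint are adjacent; disjoint ones
    see each other through \<open>{0, 1}\<close>, the one vertex of the line graph left out of
    \<open>?X\<close>.\<close>
  proof (cases "(e, f) \<in> parcs (line_graph bull)")
    case True
    then show ?thesis
      using \<open>e \<noteq> f\<close> by (rule line_bull.visible_of_arc)
  next
    case False
    have "(e, {0, 1}) \<in> parcs (line_graph bull)" "({0, 1}, f) \<in> parcs (line_graph bull)"
      using X[OF that(1)] X[OF that(2)] centre(1) by (auto simp: line_graph_def)
    moreover have "e \<noteq> {0, 1}" "{0, 1} \<noteq> f"
      using X[OF that(1)] X[OF that(2)] by blast+
    ultimately show ?thesis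
      using False \<open>e \<noteq> f\<close> centre(2) by (intro line_bull.visible_of_common_neighbour)
  qed
  have "?X \<subseteq> pverts (line_graph bull)"
    by (simp add: line_graph_def uedges_bull)
  then have "mutual_visibility_set (line_graph bull) ?X"
    unfolding mutual_visibility_set_def by (intro conjI ballI impI vis)
  then have "card ?X \<le> mutual_visibility_number (line_graph bull)"
    by (rule line_bull.card_le_mutual_visibility_number)
  moreover have "card ?X = 4"
    by (simp add: doubleton_eq_iff)
  ultimately show ?thesis
    by simp
qed

theorem proposition13:
  shows "\<exists>G :: nat pair_pre_digraph. pair_graph G \<and> unicyclic G \<and>
    mutual_visibility_number (line_graph G) \<noteq> mutual_visibility_number G"
proof -
  have "mutual_visibility_number bull < mutual_visibility_number (line_graph bull)"
    using mutual_visibility_number_bull mutual_visibility_number_line_graph_bull by linarith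
  with pair_graph_bull unicyclic_bull show ?thesis
    by (intro exI[of _ bull]) simp
qed

end
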